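(* Let $\mathcal{F}=\{f_i\}_{i\in I}$ be a $J$-frame for a Krein space $\mathcal{H}$. Then $\mathcal{F}$ is a Parseval $J$-frame for $\mathcal{H}$ if and only if $\mathcal{F}_+=\{f_i\}_{i\in I_+}$ is a Parseval frame for the Hilbert space $(\mathcal{M}_+,[\cdot,\cdot])$, $\mathcal{F}_-=\{f_i\}_{i\in I_-}$ is a Parseval frame for the Hilbert space $(\mathcal{M}_-,-[\cdot,\cdot])$, and $\mathcal{M}_-=\mathcal{M}_+^{[\perp]}$.
   Context: A (complex) Krein space is a vector space $\mathcal{H}$ with a hermitian sesquilinear form $[\cdot,\cdot]$ admitting a fundamental decomposition $\mathcal{H}=\mathcal{H}_+\dotplus\mathcal{H}_-$, direct and $[\cdot,\cdot]$-orthogonal, with $(\mathcal{H}_+,[\cdot,\cdot])$ and $(\mathcal{H}_-,-[\cdot,\cdot])$ Hilbert spaces. Fix one; the associated Hilbert inner product is $\langle x,y\rangle=[x_+,y_+]-[x_-,y_-]$, with norm $\|\cdot\|$ (the topology does not depend on the decomposition). For a subspace $\mathcal{S}$, $\mathcal{S}^{[\perp]}=\{x:[x,s]=0\ \forall s\in\mathcal{S}\}$. A subspace $\mathcal{S}$ is uniformly $J$-positive (resp. uniformly $J$-negative) if there is $\alpha>0$ with $[x,x]\ge\alpha\|x\|^2$ (resp. $-[x,x]\ge\alpha\|x\|^2$) for all $x\in\mathcal{S}$; it is maximal if it is maximal under inclusion among such subspaces. The adjoint $T^+$ of a bounded operator between Krein spaces is defined by $[Tx,y]=[x,T^+y]$.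 A Bessel family is $\mathcal{F}=\{f_i\}_{i\in I}\subset\mathcal{H}$ with $\sum_i|\langle f,f_i\rangle|^2\le\beta\|f\|^2$ for all $f\in\mathcal{H}$ and some $\beta>0$; its synthesis operator is the bounded operator $T:\ell_2(I)\to\mathcal{H}$, $Tx=\sum_{i\in I}x_if_i$. Put $I_+=\{i: [f_i,f_i]\ge0\}$, $I_-=\{i:[f_i,f_i]<0\}$; $P_\pm$ is the orthogonal projection of $\ell_2(I)$ onto $\ell_2(I_\pm)$, $T_\pm=TP_\pm$ and $\mathcal{M}_\pm=\overline{\operatorname{span}\{f_i:i\in I_\pm\}}$. The Bessel family $\mathcal{F}$ is a $J$-frame for $\mathcal{H}$ if the range $R(T_+)$ is a maximal uniformly $J$-positive subspace and $R(T_-)$ is a maximal uniformly $J$-negative subspace of $\mathcal{H}$ (then $R(T_\pm)=\mathcal{M}_\pm$). Given a $J$-frame, $\ell_2(I)$ is the Krein space with $[x,y]_2=\sum_{i\in I_+}x_i\overline{y_i}-\sum_{i\in I_-}x_i\overline{y_i}$, and $T^+$ is taken with respect to this form. The $J$-frame $\mathcal{F}$ is a Parseval $J$-frame if $TT^+=I$. The family $\mathcal{F}_\pm$ is a Parseval frame for $(\mathcal{M}_\pm,\pm[\cdot,\cdot])$ if $\sum_{i\in I_\pm}|[f,f_i]|^2=\pm[f,f]$ for every $f\in\mathcal{M}_\pm$. *)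

theory Defs
  imports "HOL-Analysis.Analysis"
begin

locale hermitian_space = C: vector_space scaleC
  for scaleC :: "complex \<Rightarrow> 'a::ab_group_add \<Rightarrow> 'a" +
  fixes form :: "'a \<Rightarrow> 'a \<Rightarrow> complex"
  assumes form_add_left: "form (x + y) z = form x z + form y z"
    and form_scaleC_left: "form (scaleC c x) z = c * form x z"
    and form_hermitian: "form y x = cnj (form x y)"
begin

text \<open>The hermitian form \<open>g\<close> makes the linear subspace \<open>S\<close> a Hilbert space. The modulus in the
  distance only matters outside \<open>S\<close>: \<^const>\<open>Metric_space\<close> wants a distance that is nonnegative on
  the whole type and \<open>g\<close> may be negative off \<open>S\<close>.\<close>

definition hilbert_subspace :: "('a \<Rightarrow> 'a \<Rightarrow> complex) \<Rightarrow> 'a set \<Rightarrow> bool" where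
  "hilbert_subspace g S \<longleftrightarrow>
     C.subspace S \<and>
     (\<forall>x\<in>S. x \<noteq> 0 \<longrightarrow> Re (g x x) > 0) \<and>
     Metric_space.mcomplete S (\<lambda>x y. sqrt (cmod (g (x - y) (x - y))))"

definition fundamental_decomposition :: "'a set \<Rightarrow> 'a set \<Rightarrow> bool" where
  "fundamental_decomposition Hp Hm \<longleftrightarrow>
     hilbert_subspace form Hp \<and>
     hilbert_subspace (\<lambda>x y. - form x y) Hm \<and>
     (\<forall>p\<in>Hp. \<forall>q\<in>Hm. form p q = 0) \<and>
     Hp \<inter> Hm = {0} \<and>
     (\<forall>x. \<exists>p\<in>Hp. \<exists>q\<in>Hm. x = p + q)"

definition pos_part :: "'a set \<Rightarrow> 'a set \<Rightarrow> 'a \<Rightarrow> 'a" where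
  "pos_part Hp Hm x = (THE p. p \<in> Hp \<and> (\<exists>q\<in>Hm. x = p + q))"

definition neg_part :: "'a set \<Rightarrow> 'a set \<Rightarrow> 'a \<Rightarrow> 'a" where
  "neg_part Hp Hm x = (THE q. q \<in> Hm \<and> (\<exists>p\<in>Hp. x = p + q))"

definition hilbert_ip :: "'a set \<Rightarrow> 'a set \<Rightarrow> 'a \<Rightarrow> 'a \<Rightarrow> complex" where
  "hilbert_ip Hp Hm x y =
     form (pos_part Hp Hm x) (pos_part Hp Hm y) - form (neg_part Hp Hm x) (neg_part Hp Hm y)"

definition orth_compl :: "'a set \<Rightarrow> 'a set" where
  "orth_compl S = {x. \<forall>s\<in>S. form x s = 0}"

end

text \<open>A Krein space with a fixed fundamental decomposition. The norm of the type (and hence its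
  topology, used for closures and infinite sums) is the norm of the associated Hilbert inner
  product.\<close>

locale krein_space = hermitian_space scaleC form
  for scaleC :: "complex \<Rightarrow> 'a::real_normed_vector \<Rightarrow> 'a"
    and form :: "'a \<Rightarrow> 'a \<Rightarrow> complex" +
  fixes Hp Hm :: "'a set"
  assumes decomposition: "fundamental_decomposition Hp Hm"
    and scaleC_of_real: "scaleC (complex_of_real r) x = r *\<^sub>R x"
    and norm_eq: "norm x = sqrt (Re (hilbert_ip Hp Hm x x))"

definition ell2 :: "'i set \<Rightarrow> ('i \<Rightarrow> complex) set" where
  "ell2 I = {x. (\<forall>i. i \<notin> I \<longrightarrow> x i = 0) \<and> (\<lambda>i. (cmod (x i))\<^sup>2) summable_on I}"

text \<open>On \<^term>\<open>ell2 I\<close> with \<^term>\<open>A \<subseteq> I\<close>, the orthogonal projection onto \<^term>\<open>ell2 A\<close>.\<close>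

definition ell2_proj :: "'i set \<Rightarrow> ('i \<Rightarrow> complex) \<Rightarrow> ('i \<Rightarrow> complex)" where
  "ell2_proj A x = (\<lambda>i. if i \<in> A then x i else 0)"

text \<open>The adjoint, with respect to the forms \<open>g1\<close> and \<open>g2\<close>, of an operator \<open>T\<close> from the space with
  carrier \<open>D\<close> to a space whose carrier is the whole type.\<close>

definition form_adjoint ::
  "'x set \<Rightarrow> ('x \<Rightarrow> 'x \<Rightarrow> complex) \<Rightarrow> ('y \<Rightarrow> 'y \<Rightarrow> complex) \<Rightarrow> ('x \<Rightarrow> 'y) \<Rightarrow> 'y \<Rightarrow> 'x" where
  "form_adjoint D g1 g2 T y = (THE z. z \<in> D \<and> (\<forall>x\<in>D. g2 (T x) y = g1 x z))"

definition parseval_frame_for :: "('a \<Rightarrow> 'a \<Rightarrow> complex) \<Rightarrow> 'i set \<Rightarrow> ('i \<Rightarrow> 'a) \<Rightarrow> 'a set \<Rightarrow> bool" where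
  "parseval_frame_for g A f M \<longleftrightarrow>
     (\<forall>h\<in>M. ((\<lambda>i. (cmod (g h (f i)))\<^sup>2) has_sum Re (g h h)) A)"

context krein_space
begin

definition unif_pos :: "'a set \<Rightarrow> bool" where
  "unif_pos S \<longleftrightarrow> C.subspace S \<and> (\<exists>\<alpha>>0. \<forall>x\<in>S. Re (form x x) \<ge> \<alpha> * (norm x)\<^sup>2)"

definition unif_neg :: "'a set \<Rightarrow> bool" where
  "unif_neg S \<longleftrightarrow> C.subspace S \<and> (\<exists>\<alpha>>0. \<forall>x\<in>S. - Re (form x x) \<ge> \<alpha> * (norm x)\<^sup>2)"

definition maximal_unif_pos :: "'a set \<Rightarrow> bool" where
  "maximal_unif_pos S \<longleftrightarrow> unif_pos S \<and> (\<forall>S'. unif_pos S' \<and> S \<subseteq> S' \<longrightarrow> S' = S)"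

definition maximal_unif_neg :: "'a set \<Rightarrow> bool" where
  "maximal_unif_neg S \<longleftrightarrow> unif_neg S \<and> (\<forall>S'. unif_neg S' \<and> S \<subseteq> S' \<longrightarrow> S' = S)"

definition bessel_family :: "'i set \<Rightarrow> ('i \<Rightarrow> 'a) \<Rightarrow> bool" where
  "bessel_family I f \<longleftrightarrow>
     (\<exists>\<beta>>0. \<forall>h. (\<lambda>i. (cmod (hilbert_ip Hp Hm h (f i)))\<^sup>2) summable_on I \<and>
                 (\<Sum>\<^sub>\<infinity>i\<in>I. (cmod (hilbert_ip Hp Hm h (f i)))\<^sup>2) \<le> \<beta> * (norm h)\<^sup>2)"

definition synthesis :: "'i set \<Rightarrow> ('i \<Rightarrow> 'a) \<Rightarrow> ('i \<Rightarrow> complex) \<Rightarrow> 'a" where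
  "synthesis I f x = (\<Sum>\<^sub>\<infinity>i\<in>I. scaleC (x i) (f i))"

definition ind_pos :: "'i set \<Rightarrow> ('i \<Rightarrow> 'a) \<Rightarrow> 'i set" where
  "ind_pos I f = {i\<in>I. Re (form (f i) (f i)) \<ge> 0}"

definition ind_neg :: "'i set \<Rightarrow> ('i \<Rightarrow> 'a) \<Rightarrow> 'i set" where
  "ind_neg I f = {i\<in>I. Re (form (f i) (f i)) < 0}"

definition synthesis_pos :: "'i set \<Rightarrow> ('i \<Rightarrow> 'a) \<Rightarrow> ('i \<Rightarrow> complex) \<Rightarrow> 'a" where
  "synthesis_pos I f x = synthesis I f (ell2_proj (ind_pos I f) x)"

definition synthesis_neg :: "'i set \<Rightarrow> ('i \<Rightarrow> 'a) \<Rightarrow> ('i \<Rightarrow> complex) \<Rightarrow> 'a" where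
  "synthesis_neg I f x = synthesis I f (ell2_proj (ind_neg I f) x)"

definition M_pos :: "'i set \<Rightarrow> ('i \<Rightarrow> 'a) \<Rightarrow> 'a set" where
  "M_pos I f = closure (C.span (f ` ind_pos I f))"

definition M_neg :: "'i set \<Rightarrow> ('i \<Rightarrow> 'a) \<Rightarrow> 'a set" where
  "M_neg I f = closure (C.span (f ` ind_neg I f))"

definition J_frame :: "'i set \<Rightarrow> ('i \<Rightarrow> 'a) \<Rightarrow> bool" where
  "J_frame I f \<longleftrightarrow>
     bessel_family I f \<and>
     maximal_unif_pos (synthesis_pos I f ` ell2 I) \<and>
     maximal_unif_neg (synthesis_neg I f ` ell2 I)"

definition ell2_form :: "'i set \<Rightarrow> ('i \<Rightarrow> 'a) \<Rightarrow> ('i \<Rightarrow> complex) \<Rightarrow> ('i \<Rightarrow> complex) \<Rightarrow> complex" where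
  "ell2_form I f x y =
     (\<Sum>\<^sub>\<infinity>i\<in>ind_pos I f. x i * cnj (y i)) - (\<Sum>\<^sub>\<infinity>i\<in>ind_neg I f. x i * cnj (y i))"

definition synthesis_adjoint :: "'i set \<Rightarrow> ('i \<Rightarrow> 'a) \<Rightarrow> 'a \<Rightarrow> ('i \<Rightarrow> complex)" where
  "synthesis_adjoint I f = form_adjoint (ell2 I) (ell2_form I f) form (synthesis I f)"

definition parseval_J_frame :: "'i set \<Rightarrow> ('i \<Rightarrow> 'a) \<Rightarrow> bool" where
  "parseval_J_frame I f \<longleftrightarrow> J_frame I f \<and> synthesis I f \<circ> synthesis_adjoint I f = id"

end

end

theory Submission
  imports Defs
begin

text \<open>
  For an index set \<open>A\<close> write \<open>S\<^sub>A y = \<Sum>\<^sub>i\<^sub>\<in>\<^sub>A [y, f\<^sub>i] f\<^sub>i\<close>. The indefinite form on \<open>\<ell>\<^sub>2\<close> carries a minus sign on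
  \<open>I\<^sub>-\<close>, so the adjoint sends \<open>y\<close> to \<open>\<plusminus>[y, f\<^sub>i]\<close> for \<open>i \<in> I\<^sub>\<plusminus>\<close>, and \<open>TT\<^sup>+ = S\<^sub>+ - S\<^sub>-\<close>
  (lemma \<open>synthesis_synthesis_adjoint\<close>), where \<open>S\<^sub>\<plusminus>\<close> is \<open>S\<^sub>A\<close> for \<open>A = I\<^sub>\<plusminus>\<close> and has values in \<open>M\<^sub>\<plusminus>\<close>. The form is definite on
  \<open>M\<^sub>+\<close> and on \<open>M\<^sub>-\<close>, with opposite signs (lemma \<open>J_frame_definite\<close>), so \<open>M\<^sub>+ \<inter> M\<^sub>- = 0\<close>.

  Suppose \<open>S\<^sub>+ - S\<^sub>- = 1\<close>. For \<open>y \<in> M\<^sub>+\<close> the vector \<open>S\<^sub>-y = S\<^sub>+y - y\<close> lies in \<open>M\<^sub>+ \<inter> M\<^sub>-\<close>, hence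
  vanishes, and \<open>0 = [S\<^sub>-y, y] = \<Sum>\<^sub>i\<^sub>\<in>\<^sub>I\<^sub>- |[y, f\<^sub>i]|\<^sup>2\<close> shows that \<open>y\<close> is orthogonal to \<open>M\<^sub>-\<close>. What is
  left, \<open>S\<^sub>+y = y\<close>, gives \<open>\<Sum>\<^sub>i\<^sub>\<in>\<^sub>I\<^sub>+ |[y, f\<^sub>i]|\<^sup>2 = [S\<^sub>+y, y] = [y, y]\<close>, the Parseval identity. The negative
  side is symmetric. Finally every \<open>x\<close> is \<open>S\<^sub>+x - S\<^sub>-x\<close>; if \<open>x\<close> is orthogonal to \<open>M\<^sub>+\<close>, then so is
  \<open>S\<^sub>+x\<close>, which is therefore zero, and \<open>x \<in> M\<^sub>-\<close>.

  Conversely, the Parseval identities say that \<open>\<plusminus>S\<^sub>\<plusminus>\<close> is the identity on \<open>M\<^sub>\<plusminus>\<close>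
  (lemma \<open>parseval_reconstruction\<close>). As \<open>S\<^sub>+\<close> is symmetric for the form,
  \<open>[x - S\<^sub>+x, z] = [x, z - S\<^sub>+z] = 0\<close> for \<open>z \<in> M\<^sub>+\<close>, so that \<open>x - S\<^sub>+x \<in> M\<^sub>+\<^sup>[\<^sup>\<bottom>\<^sup>] = M\<^sub>-\<close>. Since \<open>S\<^sub>-\<close>
  vanishes on \<open>M\<^sub>+\<close> and is \<open>-1\<close> on \<open>M\<^sub>-\<close>, \<open>S\<^sub>-x = S\<^sub>-(x - S\<^sub>+x) = S\<^sub>+x - x\<close>, which is the claim.

  All of this needs \<open>T\<close> to be given by convergent sums. They converge because a Krein space is
  complete in the norm of its Hilbert inner product (lemma \<open>complete_UNIV\<close>) and because the Bessel bound
  makes the finite partial sums Cauchy (lemma \<open>synthesis_has_sum\<close>).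
\<close>

section \<open>Summability from a square-summable bound\<close>

lemma has_sum_single:
  assumes "i \<in> A" "\<And>j. j \<in> A \<Longrightarrow> j \<noteq> i \<Longrightarrow> v j = 0"
  shows "(v has_sum v i) A"
  using has_sum_cong_neutral[of A "{i}" v v "v i"] assms by (auto intro: has_sum_finiteI)

lemma has_sum_minus:
  fixes v :: "'i \<Rightarrow> 'b::topological_ab_group_add"
  shows "(v has_sum s) A \<Longrightarrow> ((\<lambda>i. - v i) has_sum - s) A"
  by (simp add: has_sum_uminus)

text \<open>The bound applied to finite sets beyond \<open>F\<^sub>0\<close>, where the tail of \<open>w\<close> is small, makes the net of
  partial sums of \<open>v\<close> Cauchy. Completeness is a hypothesis and not a type class because the
  norm of a Krein space is complete only by virtue of its fundamental decomposition.\<close>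

lemma summable_on_of_sum_bound:
  fixes v :: "'i \<Rightarrow> 'b::real_normed_vector" and w :: "'i \<Rightarrow> real"
  assumes complete: "complete (UNIV :: 'b set)"
    and w: "w summable_on A" "\<And>i. i \<in> A \<Longrightarrow> 0 \<le> w i"
    and bound: "\<And>F. finite F \<Longrightarrow> F \<subseteq> A \<Longrightarrow> (norm (sum v F))\<^sup>2 \<le> \<beta> * sum w F"
    and "\<beta> > 0"
  shows "v summable_on A"
proof -
  have "\<exists>P. eventually P (finite_subsets_at_top A) \<and>
          (\<forall>F F'. P F \<and> P F' \<longrightarrow> dist (sum v F) (sum v F') < e)" if "e > 0" for e
  proof -
    \<comment> \<open>Two tails, each of norm at most \<open>e / 4\<close>, leave the strict inequality \<open>< e\<close>.\<close>
    define \<epsilon> where "\<epsilon> = (e / 4)\<^sup>2 / \<beta>"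
    have "\<epsilon> > 0" using \<open>e > 0\<close> \<open>\<beta> > 0\<close> by (simp add: \<epsilon>_def)
    from infsum_finite_approximation[OF w(1) this]
    obtain F0 where F0: "finite F0" "F0 \<subseteq> A" "dist (sum w F0) (infsum w A) \<le> \<epsilon>" by blast
    have tail: "norm (sum v F - sum v F0) \<le> e / 4" if F: "finite F" "F0 \<subseteq> F" "F \<subseteq> A" for F
    proof -
      have "sum w F \<le> infsum w A"
        using F w by (intro finite_sum_le_infsum) auto
      then have "sum w (F - F0) \<le> \<epsilon>"
        using F F0 by (simp add: sum_diff dist_real_def)
      then have "\<beta> * sum w (F - F0) \<le> (e / 4)\<^sup>2"
        using \<open>\<beta> > 0\<close> by (simp add: \<epsilon>_def field_simps)
      moreover have "(norm (sum v (F - F0)))\<^sup>2 \<le> \<beta> * sum w (F - F0)"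
        using F by (intro bound) auto
      ultimately have "(norm (sum v (F - F0)))\<^sup>2 \<le> (e / 4)\<^sup>2" by linarith
      then have "norm (sum v (F - F0)) \<le> e / 4"
        by (rule power2_le_imp_le) (use \<open>e > 0\<close> in simp)
      then show ?thesis using F by (simp add: sum_diff)
    qed
    define P where "P F \<longleftrightarrow> finite F \<and> F0 \<subseteq> F \<and> F \<subseteq> A" for F
    have "eventually P (finite_subsets_at_top A)"
      unfolding eventually_finite_subsets_at_top P_def using F0 by blast
    moreover have "dist (sum v F) (sum v F') < e" if "P F" "P F'" for F F'
      using tail[of F] tail[of F'] that \<open>e > 0\<close>
        norm_triangle_ineq4[of "sum v F - sum v F0" "sum v F' - sum v F0"]
      by (simp add: P_def dist_norm)
    ultimately show ?thesis by blast
  qed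
  then have "cauchy_filter (filtermap (sum v) (finite_subsets_at_top A))"
    by (simp add: cauchy_filter_metric_filtermap)
  then obtain s where "filtermap (sum v) (finite_subsets_at_top A) \<le> nhds s"
    using complete complete_uniform[where S = "UNIV :: 'b set"] by force
  then show ?thesis
    by (auto simp: summable_on_def has_sum_def filterlim_def)
qed

section \<open>The Hilbert space underlying a Krein space\<close>

context hermitian_space
begin

lemma form_add_right: "form x (y + z) = form x y + form x z"
  by (metis complex_cnj_add form_add_left form_hermitian)

lemma form_scaleC_right: "form x (scaleC c y) = cnj c * form x y"
  by (metis complex_cnj_mult form_scaleC_left form_hermitian)

lemma form_zero_left [simp]: "form 0 y = 0"
  using form_add_left[of 0 0 y] by simp

lemma form_zero_right [simp]: "form y 0 = 0"
  using form_add_right[of y 0 0] by simp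

lemma form_minus_left: "form (- x) y = - form x y"
  using form_add_left[of x "- x" y] by (simp add: add_eq_0_iff2)

lemma form_minus_right: "form x (- y) = - form x y"
  using form_add_right[of x y "- y"] by (simp add: add_eq_0_iff2)

lemma form_diff_left: "form (x - y) z = form x z - form y z"
  using form_add_left[of x "- y" z] by (simp add: form_minus_left)

lemma form_diff_right: "form x (y - z) = form x y - form x z"
  using form_add_right[of x y "- z"] by (simp add: form_minus_right)

lemma Im_form_self [simp]: "Im (form x x) = 0"
  using arg_cong[OF form_hermitian[of x x], of Im] by simp

lemma form_eq_0_sym: "form x y = 0 \<longleftrightarrow> form y x = 0"
  by (metis complex_cnj_zero form_hermitian)

end

context krein_space
begin

abbreviation "pos \<equiv> pos_part Hp Hm"
abbreviation "neg \<equiv> neg_part Hp Hm"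
abbreviation "ip \<equiv> hilbert_ip Hp Hm"

lemma subspace_Hp: "C.subspace Hp" and subspace_Hm: "C.subspace Hm"
  using decomposition unfolding fundamental_decomposition_def hilbert_subspace_def by blast+

lemma form_Hp_Hm: "p \<in> Hp \<Longrightarrow> q \<in> Hm \<Longrightarrow> form p q = 0"
  using decomposition unfolding fundamental_decomposition_def by blast

lemma form_Hm_Hp: "p \<in> Hp \<Longrightarrow> q \<in> Hm \<Longrightarrow> form q p = 0"
  using form_Hp_Hm form_eq_0_sym by blast

lemma decomposition_unique:
  assumes "p \<in> Hp" "p' \<in> Hp" "q \<in> Hm" "q' \<in> Hm" "p + q = p' + q'"
  shows "p = p' \<and> q = q'"
proof -
  have "p - p' = (p + q) - (p' + q)" by simp
  also have "\<dots> = q' - q" by (simp add: assms(5))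
  finally have "p - p' = q' - q" .
  moreover have "p - p' \<in> Hp" "q' - q \<in> Hm"
    using assms subspace_Hp subspace_Hm by (auto intro: C.subspace_diff)
  moreover have "Hp \<inter> Hm = {0}"
    using decomposition by (simp add: fundamental_decomposition_def)
  ultimately have "p - p' = 0" "q' - q = 0"
    by (metis Int_iff singletonD)+
  then show ?thesis by simp
qed

lemma pos_add_eq: "p \<in> Hp \<Longrightarrow> q \<in> Hm \<Longrightarrow> pos (p + q) = p"
  unfolding pos_part_def by (rule the_equality) (use decomposition_unique in blast)+

lemma neg_add_eq: "p \<in> Hp \<Longrightarrow> q \<in> Hm \<Longrightarrow> neg (p + q) = q"
  unfolding neg_part_def by (rule the_equality) (use decomposition_unique in blast)+

lemma parts: "pos x \<in> Hp" "neg x \<in> Hm" "pos x + neg x = x"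
proof -
  obtain p q where "p \<in> Hp" "q \<in> Hm" "x = p + q"
    using decomposition unfolding fundamental_decomposition_def by blast
  then show "pos x \<in> Hp" "neg x \<in> Hm" "pos x + neg x = x"
    by (auto simp: pos_add_eq neg_add_eq)
qed

lemma pos_add: "pos (x + y) = pos x + pos y" and neg_add: "neg (x + y) = neg x + neg y"
proof -
  have "(pos x + pos y) + (neg x + neg y) = (pos x + neg x) + (pos y + neg y)"
    by (simp only: ac_simps)
  then have eq: "(pos x + pos y) + (neg x + neg y) = x + y" by (simp only: parts(3))
  have "pos x + pos y \<in> Hp" "neg x + neg y \<in> Hm"
    using parts subspace_Hp subspace_Hm by (auto intro: C.subspace_add)
  then show "pos (x + y) = pos x + pos y" "neg (x + y) = neg x + neg y"
    using pos_add_eq neg_add_eq eq by metis+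
qed

lemma pos_scaleC: "pos (scaleC c x) = scaleC c (pos x)"
  and neg_scaleC: "neg (scaleC c x) = scaleC c (neg x)"
proof -
  have eq: "scaleC c (pos x) + scaleC c (neg x) = scaleC c x"
    by (simp only: parts(3) flip: C.scale_right_distrib)
  have "scaleC c (pos x) \<in> Hp" "scaleC c (neg x) \<in> Hm"
    using parts subspace_Hp subspace_Hm by (auto intro: C.subspace_scale)
  then show "pos (scaleC c x) = scaleC c (pos x)" "neg (scaleC c x) = scaleC c (neg x)"
    using pos_add_eq neg_add_eq eq by metis+
qed

lemma hermitian_space_ip: "hermitian_space scaleC ip"
proof
  show "ip (x + y) z = ip x z + ip y z" for x y z
    by (simp add: hilbert_ip_def pos_add neg_add form_add_left)
  show "ip (scaleC c x) z = c * ip x z" for c x z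
    by (simp add: hilbert_ip_def pos_scaleC neg_scaleC form_scaleC_left algebra_simps)
  show "ip y x = cnj (ip x y)" for x y
    by (simp add: hilbert_ip_def flip: form_hermitian)
qed

interpretation ip: hermitian_space scaleC ip
  by (rule hermitian_space_ip)

lemma ip_self_nonneg: "0 \<le> Re (ip x x)"
  using norm_ge_zero[of x] by (simp only: norm_eq real_sqrt_ge_0_iff)

lemma Re_ip_self: "Re (ip x x) = (norm x)\<^sup>2"
  by (simp only: norm_eq real_sqrt_pow2 ip_self_nonneg)

lemma ip_self: "ip x x = complex_of_real ((norm x)\<^sup>2)"
  by (rule complex_eqI) (simp_all only: Re_ip_self ip.Im_form_self Re_complex_of_real Im_complex_of_real)

lemma norm_scaleC: "norm (scaleC c x) = cmod c * norm x"
proof -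
  have "ip (scaleC c x) (scaleC c x) = (c * cnj c) * ip x x"
    by (simp add: ip.form_scaleC_left ip.form_scaleC_right)
  also have "\<dots> = complex_of_real ((cmod c)\<^sup>2 * (norm x)\<^sup>2)"
    by (simp add: ip_self flip: complex_norm_square)
  finally have "(norm (scaleC c x))\<^sup>2 = (cmod c * norm x)\<^sup>2"
    by (simp only: ip_self of_real_eq_iff power_mult_distrib)
  then show ?thesis by simp
qed

lemma cauchy_schwarz_ip: "cmod (ip x y) \<le> norm x * norm y"
proof (cases "y = 0")
  case False
  define b where "b = (norm y)\<^sup>2"
  define c where "c = ip x y"
  have "b > 0" using False by (simp add: b_def)
  \<comment> \<open>\<open>b\<close> times the component of \<open>x\<close> orthogonal to \<open>y\<close>; its square being nonnegative is the claim.\<close>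
  define z where "z = scaleC (complex_of_real b) x - scaleC c y"
  have yx: "ip y x = cnj c" by (simp add: c_def flip: ip.form_hermitian)
  have "ip z z = complex_of_real b * (complex_of_real b * ip x x - c * cnj c)"
    unfolding z_def
    by (simp add: ip.form_diff_left ip.form_diff_right ip.form_scaleC_left ip.form_scaleC_right
        yx flip: c_def) (simp add: ip_self b_def algebra_simps)
  also have "\<dots> = complex_of_real (b * (b * (norm x)\<^sup>2 - (cmod c)\<^sup>2))"
    by (simp add: ip_self flip: complex_norm_square)
  finally have "b * (b * (norm x)\<^sup>2 - (cmod c)\<^sup>2) \<ge> 0"
    using ip_self_nonneg[of z] by simp
  then have "(cmod c)\<^sup>2 \<le> (norm x * norm y)\<^sup>2"
    using \<open>b > 0\<close> by (simp add: zero_le_mult_iff b_def power_mult_distrib mult.commute)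
  then show ?thesis
    unfolding c_def by (rule power2_le_imp_le) simp
qed simp

text \<open>The fundamental symmetry \<open>J\<close>. It relates the two forms by \<open>[x, y] = \<langle>J x, y\<rangle>\<close> and is isometric, so
  boundedness of the form and the Bessel bound for \<open>[\<cdot>, f\<^sub>i]\<close> are inherited from the inner product.\<close>

definition symmetry :: "'a \<Rightarrow> 'a" where
  "symmetry x = pos x - neg x"

lemma parts_symmetry: "pos (symmetry x) = pos x" "neg (symmetry x) = - neg x"
proof -
  have "- neg x \<in> Hm" using parts subspace_Hm by (simp add: C.subspace_neg)
  then show "pos (symmetry x) = pos x" "neg (symmetry x) = - neg x"
    using pos_add_eq[of "pos x" "- neg x"] neg_add_eq[of "pos x" "- neg x"] parts(1)[of x]
    by (simp_all add: symmetry_def)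
qed

lemma form_eq_ip: "form x y = ip (symmetry x) y"
proof -
  have "form x y = form (pos x + neg x) (pos y + neg y)" by (simp only: parts(3))
  also have "\<dots> = ip (symmetry x) y"
    using form_Hp_Hm[OF parts(1)[of x] parts(2)[of y]] form_Hm_Hp[OF parts(1)[of y] parts(2)[of x]]
    by (simp only: form_add_left form_add_right hilbert_ip_def parts_symmetry form_minus_left) simp
  finally show ?thesis .
qed

lemma norm_symmetry: "norm (symmetry x) = norm x"
  by (simp add: norm_eq hilbert_ip_def parts_symmetry form_minus_left form_minus_right)

lemma cmod_form_le: "cmod (form x y) \<le> norm x * norm y"
  using cauchy_schwarz_ip[of "symmetry x" y] by (simp add: form_eq_ip norm_symmetry)

lemma bounded_bilinear_form: "bounded_bilinear form"
proof
  show "form (r *\<^sub>R x) y = r *\<^sub>R form x y" for r x y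
    by (simp flip: scaleC_of_real add: form_scaleC_left scaleR_conv_of_real)
  show "form x (r *\<^sub>R y) = r *\<^sub>R form x y" for r x y
    by (simp flip: scaleC_of_real add: form_scaleC_right scaleR_conv_of_real)
  show "\<exists>K. \<forall>x y. norm (form x y) \<le> norm x * norm y * K"
    using cmod_form_le by (intro exI[of _ 1]) simp
qed (simp_all add: form_add_left form_add_right)

lemma bounded_linear_scaleC: "bounded_linear (scaleC c)"
proof (rule bounded_linear_intro)
  show "scaleC c (r *\<^sub>R x) = r *\<^sub>R scaleC c x" for r x
    by (simp flip: scaleC_of_real add: C.scale_left_commute)
  show "norm (scaleC c x) \<le> norm x * cmod c" for x by (simp add: norm_scaleC)
qed (simp add: C.scale_right_distrib)

lemma subspace_closure:
  assumes "C.subspace S" shows "C.subspace (closure S)"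
proof (rule C.subspaceI)
  show "0 \<in> closure S" by (rule subsetD[OF closure_subset C.subspace_0[OF assms]])
  show "x + y \<in> closure S" if xy: "x \<in> closure S" "y \<in> closure S" for x y
  proof -
    obtain X Y where X: "\<forall>n. X n \<in> S" "X \<longlonglongrightarrow> x" and Y: "\<forall>n. Y n \<in> S" "Y \<longlonglongrightarrow> y"
      using xy unfolding closure_sequential by blast
    have "\<forall>n. X n + Y n \<in> S" using X(1) Y(1) C.subspace_add[OF assms] by blast
    then show ?thesis
      unfolding closure_sequential
      using tendsto_add[OF X(2) Y(2)] by (intro exI[of _ "\<lambda>n. X n + Y n"] conjI)
  qed
  show "scaleC c x \<in> closure S" if x: "x \<in> closure S" for c x
  proof -
    obtain X where X: "\<forall>n. X n \<in> S" "X \<longlonglongrightarrow> x"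
      using x unfolding closure_sequential by blast
    have "\<forall>n. scaleC c (X n) \<in> S" using X(1) C.subspace_scale[OF assms] by blast
    then show ?thesis
      unfolding closure_sequential
      using bounded_linear.tendsto[OF bounded_linear_scaleC X(2), of c]
      by (intro exI[of _ "\<lambda>n. scaleC c (X n)"] conjI)
  qed
qed

lemma norm_pos_le: "norm (pos x) \<le> norm x" and norm_neg_le: "norm (neg x) \<le> norm x"
proof -
  have 0: "0 \<in> Hp" "0 \<in> Hm" using subspace_Hp subspace_Hm C.subspace_0 by auto
  have p: "pos (pos x) = pos x" "neg (pos x) = 0"
    using pos_add_eq[of "pos x" 0] neg_add_eq[of "pos x" 0] 0 parts by auto
  have n: "pos (neg x) = 0" "neg (neg x) = neg x"
    using pos_add_eq[of 0 "neg x"] neg_add_eq[of 0 "neg x"] 0 parts by auto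
  have "Re (ip x x) = Re (ip (pos x) (pos x)) + Re (ip (neg x) (neg x))"
    by (simp add: hilbert_ip_def p n)
  then have "(norm x)\<^sup>2 = (norm (pos x))\<^sup>2 + (norm (neg x))\<^sup>2"
    by (simp add: Re_ip_self)
  then have "(norm (pos x))\<^sup>2 \<le> (norm x)\<^sup>2" "(norm (neg x))\<^sup>2 \<le> (norm x)\<^sup>2"
    by auto
  then show "norm (pos x) \<le> norm x" "norm (neg x) \<le> norm x"
    by (auto intro: power2_le_imp_le)
qed

lemma cmod_form_Hp: "x \<in> Hp \<Longrightarrow> sqrt (cmod (form x x)) = norm x"
  and cmod_form_Hm: "x \<in> Hm \<Longrightarrow> sqrt (cmod (- form x x)) = norm x"
proof -
  have 0: "0 \<in> Hp" "0 \<in> Hm" using subspace_Hp subspace_Hm C.subspace_0 by auto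
  show "sqrt (cmod (form x x)) = norm x" if "x \<in> Hp"
  proof -
    have "form x x = ip x x"
      using pos_add_eq[of x 0] neg_add_eq[of x 0] 0 that by (simp add: hilbert_ip_def)
    then show ?thesis by (simp only: ip_self norm_of_real) simp
  qed
  show "sqrt (cmod (- form x x)) = norm x" if "x \<in> Hm"
  proof -
    have "- form x x = ip x x"
      using pos_add_eq[of 0 x] neg_add_eq[of 0 x] 0 that by (simp add: hilbert_ip_def)
    then show ?thesis by (simp only: ip_self norm_of_real) simp
  qed
qed

text \<open>A Hilbert subspace is complete for a distance that is a metric only on that subspace. Once this
  distance is known to agree there with the one of the type, completeness becomes ordinary convergence.\<close>

lemma hilbert_subspace_convergent:
  assumes "hilbert_subspace g S" and norm_g: "\<And>x. x \<in> S \<Longrightarrow> sqrt (cmod (g x x)) = norm x"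
    and g_minus: "\<And>x. g (- x) (- x) = g x x"
    and "\<And>n. X n \<in> S" and "Cauchy X"
  shows "\<exists>x. X \<longlonglongrightarrow> x"
proof -
  define d where "d = (\<lambda>x y. sqrt (cmod (g (x - y) (x - y))))"
  have "C.subspace S" and complete_S: "Metric_space.mcomplete S d"
    using assms(1) by (auto simp: hilbert_subspace_def d_def)
  then have d_eq: "d x y = dist x y" if "x \<in> S" "y \<in> S" for x y
    using that norm_g[of "x - y"] C.subspace_diff by (simp add: d_def dist_norm)
  interpret Metric_space S d
  proof
    show "d x y = d y x" for x y
      using g_minus[of "x - y"] by (simp add: d_def)
    show "d x z \<le> d x y + d y z" if "x \<in> S" "y \<in> S" "z \<in> S" for x y z
      using that by (simp add: d_eq dist_triangle)
    show "d x y = 0 \<longleftrightarrow> x = y" if "x \<in> S" "y \<in> S" for x y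
      using that by (simp add: d_eq)
  qed (simp add: d_def)
  have "MCauchy X"
    using \<open>Cauchy X\<close> assms(4) by (auto simp: MCauchy_def d_eq Cauchy_def)
  then obtain x where "limitin mtopology X x sequentially"
    using complete_S unfolding mcomplete_def by blast
  then have "X \<longlonglongrightarrow> x"
    using assms(4) by (auto simp: limitin_metric tendsto_iff d_eq)
  then show ?thesis ..
qed

text \<open>Both projections of the fundamental decomposition are contractions, so the two components of a
  Cauchy sequence are Cauchy in their Hilbert spaces.\<close>

lemma complete_UNIV: "complete (UNIV :: 'a set)"
proof -
  have "\<exists>x. X \<longlonglongrightarrow> x" if "Cauchy X" for X :: "nat \<Rightarrow> 'a"
  proof -
    have diff: "pos (x - y) = pos x - pos y" "neg (x - y) = neg x - neg y" for x y
      using pos_add[of "x - y" y] neg_add[of "x - y" y] by simp_all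
    have Cauchy_pos: "Cauchy (\<lambda>n. pos (X n))" and Cauchy_neg: "Cauchy (\<lambda>n. neg (X n))"
      using that unfolding Cauchy_def dist_norm diff[symmetric]
      by (meson norm_pos_le norm_neg_le order_le_less_trans)+
    have hilbert_Hp: "hilbert_subspace form Hp"
      and hilbert_Hm: "hilbert_subspace (\<lambda>x y. - form x y) Hm"
      using decomposition unfolding fundamental_decomposition_def by blast+
    obtain p where p: "(\<lambda>n. pos (X n)) \<longlonglongrightarrow> p"
      using hilbert_subspace_convergent[of form Hp, OF _ cmod_form_Hp _ parts(1) Cauchy_pos]
        hilbert_Hp by (auto simp: form_minus_left form_minus_right)
    obtain q where q: "(\<lambda>n. neg (X n)) \<longlonglongrightarrow> q"
      using hilbert_subspace_convergent[of "\<lambda>x y. - form x y" Hm, OF _ cmod_form_Hm _ parts(2)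
          Cauchy_neg] hilbert_Hm by (auto simp: form_minus_left form_minus_right)
    from tendsto_add[OF p q] show ?thesis by (auto simp: parts(3))
  qed
  then show ?thesis by (simp add: complete_def)
qed

section \<open>Bessel families and the operator \<open>y \<mapsto> \<Sum>\<^sub>i [y, f\<^sub>i] f\<^sub>i\<close>\<close>

lemma bessel_family_subset:
  assumes "bessel_family I f" "A \<subseteq> I"
  shows "bessel_family A f"
proof -
  obtain \<beta> where "\<beta> > 0" and \<beta>: "\<And>h. (\<lambda>i. (cmod (ip h (f i)))\<^sup>2) summable_on I"
      "\<And>h. (\<Sum>\<^sub>\<infinity>i\<in>I. (cmod (ip h (f i)))\<^sup>2) \<le> \<beta> * (norm h)\<^sup>2"
    using assms(1) by (auto simp: bessel_family_def)
  have sub: "(\<lambda>i. (cmod (ip h (f i)))\<^sup>2) summable_on A" for h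
    using \<beta>(1) assms(2) by (rule summable_on_subset_banach)
  moreover have "(\<Sum>\<^sub>\<infinity>i\<in>A. (cmod (ip h (f i)))\<^sup>2) \<le> \<beta> * (norm h)\<^sup>2" for h
    using infsum_mono2[OF sub \<beta>(1) assms(2), of h] \<beta>(2)[of h] by simp
  ultimately show ?thesis using \<open>\<beta> > 0\<close> by (auto simp: bessel_family_def)
qed

lemma bessel_family_summable_form:
  assumes "bessel_family I f"
  shows "(\<lambda>i. (cmod (form y (f i)))\<^sup>2) summable_on I"
  using assms by (auto simp: bessel_family_def form_eq_ip)

text \<open>The finite bound \<open>\<parallel>\<Sum>\<^sub>i\<^sub>\<in>\<^sub>F x\<^sub>i f\<^sub>i\<parallel>\<^sup>2 \<le> \<beta> \<Sum>\<^sub>i\<^sub>\<in>\<^sub>F |x\<^sub>i|\<^sup>2\<close> is dual to the Bessel inequality. With \<open>u\<close> the partial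
  sum, \<open>\<parallel>u\<parallel>\<^sup>2 = \<Sum>\<^sub>i\<^sub>\<in>\<^sub>F x\<^sub>i \<langle>f\<^sub>i, u\<rangle>\<close>, and the weighted inequality \<open>2ab \<le> \<beta>a\<^sup>2 + b\<^sup>2/\<beta>\<close> bounds this by half of
  \<open>\<beta> \<Sum>\<^sub>i\<^sub>\<in>\<^sub>F |x\<^sub>i|\<^sup>2 + \<parallel>u\<parallel>\<^sup>2\<close>, where \<open>\<parallel>u\<parallel>\<^sup>2\<close> can be absorbed on the left.\<close>

lemma synthesis_has_sum:
  assumes "bessel_family I f" and x: "(\<lambda>i. (cmod (x i))\<^sup>2) summable_on I"
  shows "((\<lambda>i. scaleC (x i) (f i)) has_sum synthesis I f x) I"
proof -
  obtain \<beta> where "\<beta> > 0" and \<beta>: "\<And>h. (\<lambda>i. (cmod (ip h (f i)))\<^sup>2) summable_on I"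
      "\<And>h. (\<Sum>\<^sub>\<infinity>i\<in>I. (cmod (ip h (f i)))\<^sup>2) \<le> \<beta> * (norm h)\<^sup>2"
    using assms(1) by (auto simp: bessel_family_def)
  have "(norm (\<Sum>i\<in>F. scaleC (x i) (f i)))\<^sup>2 \<le> \<beta> * (\<Sum>i\<in>F. (cmod (x i))\<^sup>2)"
    if F: "finite F" "F \<subseteq> I" for F
  proof -
    define u where "u = (\<Sum>i\<in>F. scaleC (x i) (f i))"
    define c where "c = (\<lambda>i. ip u (f i))"
    have ip_sum: "ip (\<Sum>i\<in>F. v i) u = (\<Sum>i\<in>F. ip (v i) u)" for v
      using \<open>finite F\<close> by induction (simp_all add: ip.form_add_left)
    have "ip u u = (\<Sum>i\<in>F. x i * cnj (c i))"
      by (subst u_def, subst ip_sum)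
        (simp add: ip.form_scaleC_left c_def flip: ip.form_hermitian)
    then have "(norm u)\<^sup>2 = Re (\<Sum>i\<in>F. x i * cnj (c i))"
      by (simp flip: Re_ip_self)
    also have "\<dots> \<le> (\<Sum>i\<in>F. (\<beta> * (cmod (x i))\<^sup>2 + (cmod (c i))\<^sup>2 / \<beta>) / 2)"
      unfolding Re_sum
    proof (rule sum_mono)
      fix i
      have "Re (x i * cnj (c i)) \<le> cmod (x i) * cmod (c i)"
        using complex_Re_le_cmod[of "x i * cnj (c i)"] by (simp add: norm_mult)
      also have "\<dots> \<le> (\<beta> * (cmod (x i))\<^sup>2 + (cmod (c i))\<^sup>2 / \<beta>) / 2"
        using \<open>\<beta> > 0\<close> zero_le_power2[of "\<beta> * cmod (x i) - cmod (c i)"]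
        by (simp add: field_simps power2_eq_square)
      finally show "Re (x i * cnj (c i)) \<le> (\<beta> * (cmod (x i))\<^sup>2 + (cmod (c i))\<^sup>2 / \<beta>) / 2" .
    qed
    also have "\<dots> = (\<beta> * (\<Sum>i\<in>F. (cmod (x i))\<^sup>2) + (\<Sum>i\<in>F. (cmod (c i))\<^sup>2) / \<beta>) / 2"
      by (simp add: sum.distrib sum_distrib_left flip: sum_divide_distrib)
    finally have "2 * (norm u)\<^sup>2 \<le> \<beta> * (\<Sum>i\<in>F. (cmod (x i))\<^sup>2) + (\<Sum>i\<in>F. (cmod (c i))\<^sup>2) / \<beta>"
      by simp
    moreover have "(\<Sum>i\<in>F. (cmod (c i))\<^sup>2) \<le> \<beta> * (norm u)\<^sup>2"
      using finite_sum_le_infsum[OF \<beta>(1)[of u] F] \<beta>(2)[of u] by (auto simp: c_def)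
    then have "(\<Sum>i\<in>F. (cmod (c i))\<^sup>2) / \<beta> \<le> (norm u)\<^sup>2"
      using \<open>\<beta> > 0\<close> by (simp add: field_simps)
    ultimately show ?thesis by (simp add: u_def)
  qed
  then have "(\<lambda>i. scaleC (x i) (f i)) summable_on I"
    by (intro summable_on_of_sum_bound[OF complete_UNIV x _ _ \<open>\<beta> > 0\<close>]) auto
  then show ?thesis by (simp add: synthesis_def)
qed

lemma form_synthesis_has_sum:
  assumes "bessel_family I f" and "(\<lambda>i. (cmod (x i))\<^sup>2) summable_on I"
  shows "((\<lambda>i. x i * form (f i) y) has_sum form (synthesis I f x) y) I"
  using has_sum_bounded_linear[OF bounded_bilinear.bounded_linear_left[OF bounded_bilinear_form]
      synthesis_has_sum[OF assms], of y]
  by (simp add: form_scaleC_left)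

lemma unit_vector_in_ell2:
  assumes "i \<in> I" shows "(\<lambda>j. if j = i then 1 else 0) \<in> ell2 I"
proof -
  have "(\<lambda>j. (cmod (if j = i then 1 else 0))\<^sup>2) summable_on I"
    by (rule has_sum_imp_summable, rule has_sum_single[OF assms]) simp
  then show ?thesis using assms by (auto simp: ell2_def)
qed

lemma synthesis_single:
  assumes "i \<in> I" shows "synthesis I f (\<lambda>j. if j = i then 1 else 0) = f i"
proof -
  have "((\<lambda>j. scaleC (if j = i then 1 else 0) (f j)) has_sum scaleC (if i = i then 1 else 0) (f i)) I"
    by (rule has_sum_single[OF assms]) simp
  then have "synthesis I f (\<lambda>j. if j = i then 1 else 0) = scaleC (if i = i then 1 else 0) (f i)"
    unfolding synthesis_def by (rule infsumI)
  then show ?thesis by simp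
qed

abbreviation closed_span :: "'i set \<Rightarrow> ('i \<Rightarrow> 'a) \<Rightarrow> 'a set" where
  "closed_span A f \<equiv> closure (C.span (f ` A))"

lemma subspace_closed_span: "C.subspace (closed_span A f)"
  by (rule subspace_closure[OF C.subspace_span])

lemma image_subset_closed_span: "f ` A \<subseteq> closed_span A f"
  using C.span_superset closure_subset by (rule order_trans)

lemma synthesis_in_closed_span:
  assumes "bessel_family A f" and "(\<lambda>i. (cmod (x i))\<^sup>2) summable_on A"
  shows "synthesis A f x \<in> closed_span A f"
proof (rule Lim_in_closed_set)
  show "(sum (\<lambda>i. scaleC (x i) (f i)) \<longlongrightarrow> synthesis A f x) (finite_subsets_at_top A)"
    using synthesis_has_sum[OF assms] by (simp add: has_sum_def)
  have "(\<Sum>i\<in>F. scaleC (x i) (f i)) \<in> closed_span A f" if "F \<subseteq> A" for F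
  proof (rule C.subspace_sum[OF subspace_closed_span])
    fix i assume "i \<in> F"
    with that have "f i \<in> closed_span A f"
      using image_subset_closed_span[of f A] by blast
    then show "scaleC (x i) (f i) \<in> closed_span A f"
      by (rule C.subspace_scale[OF subspace_closed_span])
  qed
  then show "\<forall>\<^sub>F F in finite_subsets_at_top A. (\<Sum>i\<in>F. scaleC (x i) (f i)) \<in> closed_span A f"
    by (rule eventually_finite_subsets_at_top_weakI)
qed (rule closed_closure finite_subsets_at_top_neq_bot)+

text \<open>The orthogonal complement of one vector is a closed subspace, by continuity of the form.\<close>

lemma orthogonal_closed_span:
  assumes "\<And>i. i \<in> A \<Longrightarrow> form (f i) y = 0" and "x \<in> closed_span A f"
  shows "form x y = 0"
proof -
  have "continuous_on UNIV (\<lambda>x. form x y)"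
    using bounded_bilinear.bounded_linear_left[OF bounded_bilinear_form]
    by (rule linear_continuous_on)
  then have "closed {x. form x y = 0}"
    by (intro closed_Collect_eq continuous_on_const)
  moreover have "C.subspace {x. form x y = 0}"
    by (auto simp: C.subspace_def form_add_left form_scaleC_left)
  then have "C.span (f ` A) \<subseteq> {x. form x y = 0}"
    using assms(1) by (intro C.span_minimal) auto
  ultimately show ?thesis
    using assms(2) closure_minimal by blast
qed

text \<open>This is \<open>S\<^sub>A\<close>, taken with the indefinite form and without a sign even when \<open>A = I\<^sub>-\<close>, so that its
  properties need no case distinction between the two halves of the family.\<close>

definition frame_operator :: "'i set \<Rightarrow> ('i \<Rightarrow> 'a) \<Rightarrow> 'a \<Rightarrow> 'a" where
  "frame_operator A f y = synthesis A f (\<lambda>i. form y (f i))"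

lemma frame_operator_has_sum:
  assumes "bessel_family A f"
  shows "((\<lambda>i. form y (f i) * cnj (form z (f i))) has_sum form (frame_operator A f y) z) A"
  using form_synthesis_has_sum[OF assms bessel_family_summable_form[OF assms], of y z]
  by (simp add: frame_operator_def flip: form_hermitian)

lemma frame_operator_in_closed_span:
  "bessel_family A f \<Longrightarrow> frame_operator A f y \<in> closed_span A f"
  unfolding frame_operator_def
  by (intro synthesis_in_closed_span bessel_family_summable_form)

lemma frame_operator_symmetric:
  assumes "bessel_family A f"
  shows "form (frame_operator A f y) z = form y (frame_operator A f z)"
proof -
  have "((\<lambda>i. cnj (form z (f i) * cnj (form y (f i)))) has_sum
          cnj (form (frame_operator A f z) y)) A"
    using frame_operator_has_sum[OF assms] by (simp only: has_sum_cnj_iff)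
  then have "((\<lambda>i. form y (f i) * cnj (form z (f i))) has_sum
          form y (frame_operator A f z)) A"
    by (simp add: mult.commute flip: form_hermitian)
  with frame_operator_has_sum[OF assms] show ?thesis by (rule has_sum_unique)
qed

lemma frame_operator_diff:
  assumes "bessel_family A f"
  shows "frame_operator A f (y - z) = frame_operator A f y - frame_operator A f z"
proof -
  have sum: "((\<lambda>i. scaleC (form y (f i)) (f i)) has_sum frame_operator A f y) A" for y
    unfolding frame_operator_def
    by (intro synthesis_has_sum assms bessel_family_summable_form)
  have "((\<lambda>i. scaleC (form (y - z) (f i)) (f i)) has_sum
      frame_operator A f y - frame_operator A f z) A"
    using has_sum_add[OF sum[of y] has_sum_minus[OF sum[of z]]]
    by (simp add: form_diff_left C.scale_left_diff_distrib)
  with sum show ?thesis by (rule has_sum_unique)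
qed

lemma frame_operator_eq_0:
  assumes "\<And>i. i \<in> A \<Longrightarrow> form y (f i) = 0"
  shows "frame_operator A f y = 0"
proof -
  have "frame_operator A f y = (\<Sum>\<^sub>\<infinity>i\<in>A. 0)"
    unfolding frame_operator_def synthesis_def by (intro infsum_cong) (simp add: assms)
  then show ?thesis by simp
qed

text \<open>Uniform definiteness is a non-strict inequality between continuous functions, so it passes from
  the span to its closure. Mere definiteness would not. The sign of \<open>\<sigma>\<close> selects the
  positive or the negative case.\<close>

lemma unif_definite_closed_span:
  assumes "C.subspace S" "f ` A \<subseteq> S" "\<alpha> > 0"
    and S: "\<And>x. x \<in> S \<Longrightarrow> \<alpha> * (norm x)\<^sup>2 \<le> \<sigma> * Re (form x x)"
    and "x \<in> closed_span A f" "\<sigma> * Re (form x x) \<le> 0"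
  shows "x = 0"
proof -
  have "closed {x. \<alpha> * (norm x)\<^sup>2 \<le> \<sigma> * Re (form x x)}"
    by (intro closed_Collect_le continuous_intros
        bounded_bilinear.continuous_on[OF bounded_bilinear_form])
  moreover have "C.span (f ` A) \<subseteq> {x. \<alpha> * (norm x)\<^sup>2 \<le> \<sigma> * Re (form x x)}"
    using C.span_minimal[OF assms(2,1)] S by auto
  ultimately have "\<alpha> * (norm x)\<^sup>2 \<le> \<sigma> * Re (form x x)"
    using assms(5) closure_minimal by blast
  then show ?thesis
    using assms(3,6) by (smt (verit) mult_pos_pos zero_less_norm_iff zero_less_power)
qed

text \<open>A Parseval frame reproduces vectors: with \<open>\<parallel>x\<parallel>\<^sup>2\<close> now denoting \<open>\<sigma>[x, x]\<close> on the closed span and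
  \<open>u = \<sigma> S\<^sub>A y\<close>, the Parseval identity for \<open>y\<close> gives \<open>Re \<sigma>[u, y] = \<parallel>y\<parallel>\<^sup>2\<close>. Comparing \<open>\<parallel>u\<parallel>\<^sup>2\<close>, the sum of the
  \<open>Re ([y, f\<^sub>i] \<cdot> cnj [u, f\<^sub>i])\<close>, termwise with the Parseval sums of \<open>y\<close> and \<open>u\<close> gives \<open>\<parallel>u\<parallel> \<le> \<parallel>y\<parallel>\<close>. Together
  they make \<open>\<parallel>y - u\<parallel>\<^sup>2 = \<parallel>u\<parallel>\<^sup>2 - \<parallel>y\<parallel>\<^sup>2\<close> nonpositive, and definiteness applies.\<close>

lemma parseval_reconstruction:
  fixes \<sigma> :: real
  assumes bessel: "bessel_family A f" and \<sigma>: "\<sigma> * \<sigma> = 1"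
    and definite: "\<And>x. x \<in> closed_span A f \<Longrightarrow> \<sigma> * Re (form x x) \<le> 0 \<Longrightarrow> x = 0"
    and parseval: "\<And>x. x \<in> closed_span A f \<Longrightarrow>
      ((\<lambda>i. (cmod (form x (f i)))\<^sup>2) has_sum \<sigma> * Re (form x x)) A"
    and y: "y \<in> closed_span A f"
  shows "\<sigma> *\<^sub>R frame_operator A f y = y"
proof -
  let ?S = "frame_operator A f y"
  define u where "u = \<sigma> *\<^sub>R ?S"
  have u: "u \<in> closed_span A f"
    unfolding u_def scaleC_of_real[symmetric]
    by (rule C.subspace_scale[OF subspace_closed_span frame_operator_in_closed_span[OF bessel]])
  have form_S: "Re (form ?S z) = \<sigma> * Re (form u z)" for z
    using \<sigma> by (simp add: u_def form_scaleC_left flip: scaleC_of_real mult.assoc)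
  have Re_form_S: "((\<lambda>i. Re (form y (f i) * cnj (form z (f i)))) has_sum \<sigma> * Re (form u z)) A" for z
    using has_sum_Re[OF frame_operator_has_sum[OF bessel, of y z]] unfolding form_S .
  have "((\<lambda>i. (cmod (form y (f i)))\<^sup>2) has_sum \<sigma> * Re (form u y)) A"
    using Re_form_S[of y] by (simp add: complex_mult_cnj cmod_power2)
  then have uy: "\<sigma> * Re (form u y) = \<sigma> * Re (form y y)"
    using parseval[OF y] by (rule has_sum_unique)
  have "\<sigma> * Re (form u u) + \<sigma> * Re (form u u) \<le> \<sigma> * Re (form y y) + \<sigma> * Re (form u u)"
  proof (rule has_sum_mono[OF has_sum_add[OF Re_form_S Re_form_S]
        has_sum_add[OF parseval[OF y] parseval[OF u]]])
    fix i
    show "Re (form y (f i) * cnj (form u (f i))) + Re (form y (f i) * cnj (form u (f i)))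
        \<le> (cmod (form y (f i)))\<^sup>2 + (cmod (form u (f i)))\<^sup>2"
      using zero_le_power2[of "Re (form y (f i)) - Re (form u (f i))"]
        zero_le_power2[of "Im (form y (f i)) - Im (form u (f i))"]
      by (simp add: cmod_power2 power2_diff mult.commute[of "Re (form u (f i))"]
          mult.commute[of "Im (form u (f i))"])
  qed
  moreover have "\<sigma> * Re (form y u) = \<sigma> * Re (form u y)"
    by (subst form_hermitian) simp
  moreover have "\<sigma> * Re (form (y - u) (y - u)) =
      \<sigma> * Re (form y y) - \<sigma> * Re (form y u) - \<sigma> * Re (form u y) + \<sigma> * Re (form u u)"
    by (simp add: form_diff_left form_diff_right algebra_simps)
  ultimately have "\<sigma> * Re (form (y - u) (y - u)) \<le> 0"
    using uy by linarith
  moreover have "y - u \<in> closed_span A f"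
    by (rule C.subspace_diff[OF subspace_closed_span y u])
  ultimately show ?thesis
    using definite[of "y - u"] by (simp add: u_def)
qed

section \<open>The adjoint of the synthesis operator\<close>

lemma ind_disjoint: "ind_pos I f \<inter> ind_neg I f = {}"
  and ind_union: "ind_pos I f \<union> ind_neg I f = I"
  by (auto simp: ind_pos_def ind_neg_def)

text \<open>The adjoint is a definite description: existence is the termwise evaluation of \<open>[T x, y]\<close>, and
  uniqueness comes from testing on the unit vectors, which \<open>T\<close> maps to the \<open>f\<^sub>i\<close>.\<close>

lemma synthesis_adjoint_eq:
  assumes bessel: "bessel_family I f"
  shows "synthesis_adjoint I f y =
    (\<lambda>i. if i \<in> ind_pos I f then form y (f i) else if i \<in> ind_neg I f then - form y (f i) else 0)"
    (is "_ = ?z")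
  unfolding synthesis_adjoint_def form_adjoint_def
proof (rule the_equality, intro conjI ballI)
  have "(\<lambda>i. (cmod (?z i))\<^sup>2) summable_on I \<longleftrightarrow> (\<lambda>i. (cmod (form y (f i)))\<^sup>2) summable_on I"
    using ind_union[of I f] by (intro summable_on_cong) auto
  then show "?z \<in> ell2 I"
    using bessel_family_summable_form[OF bessel] ind_union[of I f] by (auto simp: ell2_def)
  fix x assume "x \<in> ell2 I"
  then have sum: "((\<lambda>i. x i * form (f i) y) has_sum form (synthesis I f x) y) I"
    by (intro form_synthesis_has_sum bessel) (simp add: ell2_def)
  have summable: "(\<lambda>i. x i * form (f i) y) summable_on ind_pos I f"
    "(\<lambda>i. x i * form (f i) y) summable_on ind_neg I f"
    by (rule summable_on_subset_banach[OF has_sum_imp_summable[OF sum]],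
        use ind_union[of I f] in blast)+
  have "form (synthesis I f x) y = (\<Sum>\<^sub>\<infinity>i\<in>ind_pos I f \<union> ind_neg I f. x i * form (f i) y)"
    unfolding ind_union using sum by (rule infsumI[symmetric])
  also have "\<dots> = (\<Sum>\<^sub>\<infinity>i\<in>ind_pos I f. x i * form (f i) y) + (\<Sum>\<^sub>\<infinity>i\<in>ind_neg I f. x i * form (f i) y)"
    by (intro infsum_Un_disjoint summable ind_disjoint)
  also have "(\<Sum>\<^sub>\<infinity>i\<in>ind_pos I f. x i * form (f i) y) = (\<Sum>\<^sub>\<infinity>i\<in>ind_pos I f. x i * cnj (?z i))"
    by (intro infsum_cong) (simp flip: form_hermitian)
  also have "(\<Sum>\<^sub>\<infinity>i\<in>ind_neg I f. x i * form (f i) y) = (\<Sum>\<^sub>\<infinity>i\<in>ind_neg I f. - (x i * cnj (?z i)))"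
    using ind_disjoint[of I f] by (intro infsum_cong) (auto simp flip: form_hermitian)
  finally show "form (synthesis I f x) y = ell2_form I f x ?z"
    by (simp add: ell2_form_def infsum_uminus)
next
  fix z assume z: "z \<in> ell2 I \<and> (\<forall>x\<in>ell2 I. form (synthesis I f x) y = ell2_form I f x z)"
  show "z = ?z"
  proof
    fix i
    show "z i = ?z i"
    proof (cases "i \<in> I")
      case True
      define \<delta> :: "'b \<Rightarrow> complex" where "\<delta> = (\<lambda>j. if j = i then 1 else 0)"
      have "\<delta> \<in> ell2 I" unfolding \<delta>_def using True by (rule unit_vector_in_ell2)
      then have "form (f i) y = ell2_form I f \<delta> z"
        using z synthesis_single[OF True, of f] by (auto simp: \<delta>_def)
      moreover have "(\<Sum>\<^sub>\<infinity>j\<in>A. \<delta> j * cnj (z j)) = (if i \<in> A then cnj (z i) else 0)" for A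
      proof (cases "i \<in> A")
        case True
        then show ?thesis
          by (subst infsumI[OF has_sum_single[of i A]]) (auto simp: \<delta>_def)
      next
        case False
        then have "(\<Sum>\<^sub>\<infinity>j\<in>A. \<delta> j * cnj (z j)) = (\<Sum>\<^sub>\<infinity>j\<in>A. 0)"
          by (intro infsum_cong) (auto simp: \<delta>_def)
        then show ?thesis using False by simp
      qed
      ultimately have "form (f i) y =
          (if i \<in> ind_pos I f then cnj (z i) else 0) - (if i \<in> ind_neg I f then cnj (z i) else 0)"
        by (simp add: ell2_form_def)
      then have "form y (f i) =
          (if i \<in> ind_pos I f then z i else 0) - (if i \<in> ind_neg I f then z i else 0)"
        by (subst form_hermitian) simp
      then show ?thesis
        using True ind_disjoint[of I f] ind_union[of I f] by auto
    next
      case False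
      then show ?thesis using z by (auto simp: ell2_def ind_pos_def ind_neg_def)
    qed
  qed
qed

lemma synthesis_synthesis_adjoint:
  assumes bessel: "bessel_family I f"
  shows "synthesis I f (synthesis_adjoint I f y) =
    frame_operator (ind_pos I f) f y - frame_operator (ind_neg I f) f y"
proof -
  let ?z = "synthesis_adjoint I f y"
  have sub: "ind_pos I f \<subseteq> I" "ind_neg I f \<subseteq> I" using ind_union[of I f] by auto
  have sum: "((\<lambda>i. scaleC (form y (f i)) (f i)) has_sum frame_operator A f y) A" if "A \<subseteq> I" for A
    unfolding frame_operator_def
    by (intro synthesis_has_sum bessel_family_summable_form bessel_family_subset[OF bessel that])
  have "((\<lambda>i. scaleC (?z i) (f i)) has_sum frame_operator (ind_pos I f) f y) (ind_pos I f)"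
    using sum[OF sub(1)]
    by (rule has_sum_cong[THEN iffD1, rotated]) (simp add: synthesis_adjoint_eq[OF bessel])
  moreover have "((\<lambda>i. scaleC (?z i) (f i)) has_sum - frame_operator (ind_neg I f) f y) (ind_neg I f)"
    using has_sum_minus[OF sum[OF sub(2)]]
    by (rule has_sum_cong[THEN iffD1, rotated])
      (use ind_disjoint[of I f] in \<open>auto simp: synthesis_adjoint_eq[OF bessel]\<close>)
  ultimately have "((\<lambda>i. scaleC (?z i) (f i)) has_sum
      frame_operator (ind_pos I f) f y + - frame_operator (ind_neg I f) f y) I"
    using has_sum_Un_disjoint[OF _ _ ind_disjoint[of I f]] by (simp only: ind_union)
  then show ?thesis unfolding synthesis_def by (simp only: infsumI diff_conv_add_uminus)
qed

section \<open>Parseval J-frames\<close>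

lemma family_in_synthesis_image:
  "f ` ind_pos I f \<subseteq> synthesis_pos I f ` ell2 I"
  "f ` ind_neg I f \<subseteq> synthesis_neg I f ` ell2 I"
proof -
  have "f i = synthesis I f (ell2_proj A (\<lambda>j. if j = i then 1 else 0)) \<and>
      (\<lambda>j. if j = i then 1 else 0) \<in> ell2 I" if "i \<in> A" "A \<subseteq> I" for i A
  proof
    show "f i = synthesis I f (ell2_proj A (\<lambda>j. if j = i then 1 else 0))"
    proof -
      have "ell2_proj A (\<lambda>j. if j = i then 1 else 0) = (\<lambda>j. if j = i then 1 else 0)"
        using that by (auto simp: ell2_proj_def)
      then show ?thesis using synthesis_single[of i I f] that by auto
    qed
    show "(\<lambda>j. if j = i then 1 else 0) \<in> ell2 I"
      using that by (auto intro: unit_vector_in_ell2)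
  qed
  moreover have "ind_pos I f \<subseteq> I" "ind_neg I f \<subseteq> I" using ind_union[of I f] by auto
  ultimately show "f ` ind_pos I f \<subseteq> synthesis_pos I f ` ell2 I"
    "f ` ind_neg I f \<subseteq> synthesis_neg I f ` ell2 I"
    unfolding synthesis_pos_def synthesis_neg_def by blast+
qed

text \<open>The ranges \<open>R(T\<^sub>\<plusminus>)\<close> contain the \<open>f\<^sub>i\<close> with \<open>i \<in> I\<^sub>\<plusminus>\<close>, so the uniform bounds that hold on them extend
  to \<open>M\<^sub>\<plusminus>\<close>.\<close>

lemma J_frame_definite:
  assumes "J_frame I f"
  shows "x \<in> M_pos I f \<Longrightarrow> Re (form x x) \<le> 0 \<Longrightarrow> x = 0"
    and "x \<in> M_neg I f \<Longrightarrow> Re (form x x) \<ge> 0 \<Longrightarrow> x = 0"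
proof -
  obtain \<alpha> where "\<alpha> > 0" and subspace: "C.subspace (synthesis_pos I f ` ell2 I)"
    and \<alpha>: "\<And>x. x \<in> synthesis_pos I f ` ell2 I \<Longrightarrow> \<alpha> * (norm x)\<^sup>2 \<le> 1 * Re (form x x)"
    using assms unfolding J_frame_def maximal_unif_pos_def unif_pos_def mult_1_left by blast
  show "x = 0" if "x \<in> M_pos I f" "Re (form x x) \<le> 0"
    using unif_definite_closed_span[OF subspace family_in_synthesis_image(1) \<open>\<alpha> > 0\<close> \<alpha>, of x] that
    by (simp add: M_pos_def)
next
  obtain \<alpha> where "\<alpha> > 0" and subspace: "C.subspace (synthesis_neg I f ` ell2 I)"
    and \<alpha>: "\<And>x. x \<in> synthesis_neg I f ` ell2 I \<Longrightarrow> \<alpha> * (norm x)\<^sup>2 \<le> - 1 * Re (form x x)"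
    using assms unfolding J_frame_def maximal_unif_neg_def unif_neg_def mult_minus1 by blast
  show "x = 0" if "x \<in> M_neg I f" "Re (form x x) \<ge> 0"
    using unif_definite_closed_span[OF subspace family_in_synthesis_image(2) \<open>\<alpha> > 0\<close> \<alpha>, of x] that
    by (simp add: M_neg_def)
qed

theorem parseval_J_frame_iff:
  assumes J: "J_frame I f"
  shows "parseval_J_frame I f \<longleftrightarrow>
    parseval_frame_for form (ind_pos I f) f (M_pos I f) \<and>
    parseval_frame_for (\<lambda>x y. - form x y) (ind_neg I f) f (M_neg I f) \<and>
    M_neg I f = orth_compl (M_pos I f)"
    (is "_ \<longleftrightarrow> ?parsevals")
proof -
  let ?P = "ind_pos I f" and ?N = "ind_neg I f"
  let ?Sp = "frame_operator ?P f" and ?Sn = "frame_operator ?N f"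
  have bessel: "bessel_family I f" using J by (simp add: J_frame_def)
  have bessel_P: "bessel_family ?P f" and bessel_N: "bessel_family ?N f"
    using bessel_family_subset[OF bessel] ind_union[of I f] by blast+
  have subspace: "C.subspace (M_pos I f)" "C.subspace (M_neg I f)"
    by (simp_all add: M_pos_def M_neg_def subspace_closed_span)
  have Sp: "?Sp y \<in> M_pos I f" and Sn: "?Sn y \<in> M_neg I f" for y
    unfolding M_pos_def M_neg_def
    by (rule frame_operator_in_closed_span[OF bessel_P] frame_operator_in_closed_span[OF bessel_N])+
  have f_neg: "f i \<in> M_neg I f" if "i \<in> ?N" for i
    unfolding M_neg_def by (rule subsetD[OF image_subset_closed_span imageI[OF that]])
  have definite_pos: "x = 0" if "x \<in> M_pos I f" "Re (form x x) \<le> 0" for x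
    using J_frame_definite[OF J] that by blast
  have definite_neg: "x = 0" if "x \<in> M_neg I f" "Re (form x x) \<ge> 0" for x
    using J_frame_definite[OF J] that by blast
  have energy: "((\<lambda>i. (cmod (form y (f i)))\<^sup>2) has_sum Re (form (frame_operator A f y) y)) A"
    if "bessel_family A f" for A y
    using has_sum_Re[OF frame_operator_has_sum[OF that, of y y]]
    by (simp add: complex_mult_cnj cmod_power2)
  have disjoint: "x = 0" if "x \<in> M_pos I f" "x \<in> M_neg I f" for x
    using definite_pos[OF that(1)] definite_neg[OF that(2)] by linarith
  have parseval_iff: "parseval_J_frame I f \<longleftrightarrow> (\<forall>y. ?Sp y - ?Sn y = y)"
    using J by (simp add: parseval_J_frame_def fun_eq_iff synthesis_synthesis_adjoint[OF bessel])
  show ?thesis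
    unfolding parseval_iff
  proof
    assume id: "\<forall>y. ?Sp y - ?Sn y = y"
    \<comment> \<open>Each operator kills the other subspace, since the image lies in \<open>M\<^sub>+ \<inter> M\<^sub>-\<close>.\<close>
    have Sn_pos: "?Sn y = 0" if "y \<in> M_pos I f" for y
    proof (rule disjoint)
      have "?Sn y = ?Sp y - y" using id[rule_format, of y] by (simp add: algebra_simps)
      then show "?Sn y \<in> M_pos I f" using C.subspace_diff[OF subspace(1) Sp that] by simp
    qed (rule Sn)
    have Sp_neg: "?Sp y = 0" if "y \<in> M_neg I f" for y
    proof (rule disjoint)
      have "?Sp y = y + ?Sn y" using id[rule_format, of y] by (simp add: algebra_simps)
      then show "?Sp y \<in> M_neg I f" using C.subspace_add[OF subspace(2) that Sn] by simp
    qed (rule Sp)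
    have orth: "form x y = 0" if "x \<in> M_neg I f" "y \<in> M_pos I f" for x y
    proof -
      have "form (f i) y = 0" if "i \<in> ?N" for i
      proof -
        have "((\<lambda>i. (cmod (form y (f i)))\<^sup>2) has_sum 0) ?N"
          using energy[OF bessel_N, of y] Sn_pos[OF \<open>y \<in> M_pos I f\<close>] by simp
        then have "(cmod (form y (f i)))\<^sup>2 = 0"
          using that by (intro nonneg_has_sum_le_0D[where A = ?N]) auto
        then show ?thesis using form_eq_0_sym by simp
      qed
      then show ?thesis
        using that(1) unfolding M_neg_def by (rule orthogonal_closed_span)
    qed
    show ?parsevals
    proof (intro conjI)
      show "parseval_frame_for form ?P f (M_pos I f)"
        unfolding parseval_frame_for_def
        using energy[OF bessel_P] id Sn_pos by (metis diff_zero)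
      have "((\<lambda>i. (cmod (form y (f i)))\<^sup>2) has_sum - Re (form y y)) ?N" if "y \<in> M_neg I f" for y
      proof -
        have "?Sn y = - y" using id[rule_format, of y] Sp_neg[OF that] by (simp add: minus_equation_iff)
        then show ?thesis using energy[OF bessel_N, of y] by (simp add: form_minus_left)
      qed
      then show "parseval_frame_for (\<lambda>x y. - form x y) ?N f (M_neg I f)"
        by (simp add: parseval_frame_for_def)
      show "M_neg I f = orth_compl (M_pos I f)"
      proof
        show "M_neg I f \<subseteq> orth_compl (M_pos I f)" using orth by (auto simp: orth_compl_def)
        show "orth_compl (M_pos I f) \<subseteq> M_neg I f"
        proof
          fix x assume x: "x \<in> orth_compl (M_pos I f)"
          have "?Sp x = x + ?Sn x" using id[rule_format, of x] by (simp add: algebra_simps)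
          then have "form (?Sp x) (?Sp x) = form x (?Sp x) + form (?Sn x) (?Sp x)"
            by (metis form_add_left)
          moreover have "form x (?Sp x) = 0" using x Sp by (simp add: orth_compl_def)
          ultimately have "form (?Sp x) (?Sp x) = 0" using orth[OF Sn Sp] by simp
          then have "?Sp x = 0" using definite_pos[OF Sp] by simp
          then have "x = - ?Sn x" using id[rule_format, of x] by simp
          then show "x \<in> M_neg I f" using C.subspace_neg[OF subspace(2) Sn] by metis
        qed
      qed
    qed
  next
    assume parsevals: ?parsevals
    have Sp_id: "?Sp y = y" if "y \<in> M_pos I f" for y
      using parseval_reconstruction[OF bessel_P, of 1 y] definite_pos that parsevals
      by (simp add: parseval_frame_for_def M_pos_def)
    have Sn_id: "?Sn y = - y" if "y \<in> M_neg I f" for y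
      using parseval_reconstruction[OF bessel_N, of "-1" y] definite_neg that parsevals
      by (simp add: parseval_frame_for_def M_neg_def minus_equation_iff)
    show "\<forall>y. ?Sp y - ?Sn y = y"
    proof
      fix y
      \<comment> \<open>\<open>S\<^sub>+\<close> is the orthogonal projection onto \<open>M\<^sub>+\<close>.\<close>
      have "form (y - ?Sp y) z = 0" if "z \<in> M_pos I f" for z
        using frame_operator_symmetric[OF bessel_P, of y z] Sp_id[OF that]
        by (simp add: form_diff_left)
      then have rest: "y - ?Sp y \<in> M_neg I f" using parsevals by (simp add: orth_compl_def)
      have "?Sn (?Sp y) = 0"
      proof (rule frame_operator_eq_0)
        fix i assume "i \<in> ?N"
        then have "f i \<in> orth_compl (M_pos I f)" using f_neg parsevals by blast
        then show "form (?Sp y) (f i) = 0"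
          using Sp form_eq_0_sym by (auto simp: orth_compl_def)
      qed
      then have "?Sn y = - (y - ?Sp y)"
        using Sn_id[OF rest] frame_operator_diff[OF bessel_N, of y "?Sp y"] by simp
      then show "?Sp y - ?Sn y = y" by simp
    qed
  qed
qed

end

theorem proposition5p4:
  fixes scaleC :: "complex \<Rightarrow> 'a::real_normed_vector \<Rightarrow> 'a"
    and form :: "'a \<Rightarrow> 'a \<Rightarrow> complex"
    and Hp Hm :: "'a set"
    and I :: "'i set"
    and f :: "'i \<Rightarrow> 'a"
  assumes "krein_space scaleC form Hp Hm"
    and "krein_space.J_frame scaleC form Hp Hm I f"
  shows "krein_space.parseval_J_frame scaleC form Hp Hm I f \<longleftrightarrow>
    parseval_frame_for form
      (krein_space.ind_pos form I f) f (krein_space.M_pos scaleC form I f) \<and>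
    parseval_frame_for (\<lambda>x y. - form x y)
      (krein_space.ind_neg form I f) f (krein_space.M_neg scaleC form I f) \<and>
    krein_space.M_neg scaleC form I f =
      hermitian_space.orth_compl form (krein_space.M_pos scaleC form I f)"
  using krein_space.parseval_J_frame_iff[OF assms] .

end
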